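(* Let $(S,\leq)$ be a partially ordered set and let $\lambda\colon S\to\mathbb N$ be a length function with induced chain length function $\lambda^*\colon S\to\mathrm{Ch}(\mathbb N)$. Then there exists a map $\mu\colon S\to P$ into a partially ordered set $P$ satisfying for all $x,y\in S$ the following: (P1) $x\leq y$ implies $\mu(x)\leq\mu(y)$. (P2) $\mu(x)=\mu(y)$ implies $\lambda(x)=\lambda(y)$. (P3) If $\mu(x')<\mu(y)$ for all $x'\in S$ with $x'<x$, and $\lambda(x)\geq\lambda(y)$, then $\mu(x)\leq\mu(y)$. Moreover, for any map $\mu'\colon S\to P'$ into a partially ordered set $P'$ satisfying the conditions (P1), (P2), (P3) (with $\mu',P'$ in place of $\mu,P$), we have for all $x,y\in S$ $$\mu'(x)\leq\mu'(y)\quad\Longleftrightarrow\quad \mu(x)\leq\mu(y)\quad\Longleftrightarrow\quad \lambda^*(x)\leq\lambda^*(y).$$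
   Context: $\mathbb N=\{1,2,3,\ldots\}$. A length function on a partially ordered set $(S,\leq)$ is a map $\lambda\colon S\to\mathbb N$ such that $x<y$ in $S$ implies $\lambda(x)<\lambda(y)$. For a partially ordered set $S$, $\mathrm{Ch}(S)$ denotes the set of all finite chains (finite totally ordered subsets, including $\emptyset$) of $S$, and for $x\in S$, $\mathrm{Ch}(S,x)=\{X\in\mathrm{Ch}(S)\mid \max X=x\}$. In particular $\mathrm{Ch}(\mathbb N)$ is the set of finite subsets of $\mathbb N$; it is totally ordered by the lexicographic order: $X\leq Y$ if and only if $\min(Y\setminus X)\leq\min(X\setminus Y)$, where by convention $n<\min\emptyset$ for all $n\in\mathbb N$ (and $\min\emptyset\le\min\emptyset$). The chain length function induced by $\lambda$ is $\lambda^*\colon S\to\mathrm{Ch}(\mathbb N)$, $\lambda^*(x)=\max\{\lambda(X)\mid X\in\mathrm{Ch}(S,x)\}$, the maximum being taken in the lexicographic order, with $\lambda(X)=\{\lambda(z)\mid z\in X\}$. It is called the Gabriel-Roiter measure for $S$ with respect to $\lambda$. *)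

theory Defs
  imports "HOL-Library.Extended_Nat" "HOL-Library.FuncSet"
begin

text \<open>A partially ordered set is a carrier together with a relation \<open>r\<close> on it such that
  \<^term>\<open>partial_order_on S r\<close>; \<open>(x, y) \<in> r\<close> is read as \<open>x \<le> y\<close>.\<close>

definition strict_rel :: "'a rel \<Rightarrow> 'a \<Rightarrow> 'a \<Rightarrow> bool" where
  "strict_rel r x y \<longleftrightarrow> (x, y) \<in> r \<and> x \<noteq> y"

text \<open>Lengths are positive: the natural numbers of the theory start at 1, unlike \<^typ>\<open>nat\<close>.\<close>

definition length_function :: "'a set \<Rightarrow> 'a rel \<Rightarrow> ('a \<Rightarrow> nat) \<Rightarrow> bool" where
  "length_function S r lam \<longleftrightarrow>
     lam \<in> S \<rightarrow> {1..} \<and> (\<forall>x\<in>S. \<forall>y\<in>S. strict_rel r x y \<longrightarrow> lam x < lam y)"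

definition Ch :: "'a set \<Rightarrow> 'a rel \<Rightarrow> 'a set set" where
  "Ch S r = {X. X \<subseteq> S \<and> finite X \<and> X \<in> Chains r}"

definition Ch_max :: "'a set \<Rightarrow> 'a rel \<Rightarrow> 'a \<Rightarrow> 'a set set" where
  "Ch_max S r x = {X \<in> Ch S r. x \<in> X \<and> (\<forall>z\<in>X. (z, x) \<in> r)}"

text \<open>The lexicographic order on finite sets of natural numbers. In \<^typ>\<open>enat\<close> the infimum of
  the empty set is \<open>\<infinity>\<close>, which implements the convention that the minimum of the empty set
  exceeds every number.\<close>

definition lex_le :: "nat set \<Rightarrow> nat set \<Rightarrow> bool" where
  "lex_le X Y \<longleftrightarrow> (INF n\<in>Y - X. enat n) \<le> (INF n\<in>X - Y. enat n)"

text \<open>For \<open>x \<in> S\<close> and a length function \<open>lam\<close>, the images below are nonempty subsets of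
  \<open>{1..lam x}\<close> and hence finite in number, and \<^const>\<open>lex_le\<close> is a total order on finite sets,
  so the maximum exists and is unique.\<close>

definition gr_measure :: "'a set \<Rightarrow> 'a rel \<Rightarrow> ('a \<Rightarrow> nat) \<Rightarrow> 'a \<Rightarrow> nat set" where
  "gr_measure S r lam x =
     (THE M. M \<in> (\<lambda>X. lam ` X) ` Ch_max S r x \<and> (\<forall>X \<in> Ch_max S r x. lex_le (lam ` X) M))"

definition gr_conditions ::
  "'a set \<Rightarrow> 'a rel \<Rightarrow> ('a \<Rightarrow> nat) \<Rightarrow> 'p set \<Rightarrow> 'p rel \<Rightarrow> ('a \<Rightarrow> 'p) \<Rightarrow> bool" where
  "gr_conditions S r lam P p mu \<longleftrightarrow>
     partial_order_on P p \<and> mu \<in> S \<rightarrow> P \<and>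
     (\<forall>x\<in>S. \<forall>y\<in>S. (x, y) \<in> r \<longrightarrow> (mu x, mu y) \<in> p) \<and>
     (\<forall>x\<in>S. \<forall>y\<in>S. mu x = mu y \<longrightarrow> lam x = lam y) \<and>
     (\<forall>x\<in>S. \<forall>y\<in>S.
        (\<forall>x'\<in>S. strict_rel r x' x \<longrightarrow> strict_rel p (mu x') (mu y)) \<and> lam x \<ge> lam y
          \<longrightarrow> (mu x, mu y) \<in> p)"

end

theory Submission
  imports Defs
begin

text \<open>The Gabriel-Roiter measure itself satisfies (P1)--(P3). Conversely, a map \<open>\<mu>\<close> with (P1)--(P3)
  induces the same preorder: one shows by induction on \<open>\<lambda>(x) + \<lambda>(y)\<close> that \<open>\<lambda>\<^sup>*(x) \<le> \<lambda>\<^sup>*(y)\<close> implies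
  \<open>\<mu>(x) \<le> \<mu>(y)\<close>, strictly if \<open>\<lambda>\<^sup>*(x) < \<lambda>\<^sup>*(y)\<close>. If \<open>\<lambda>(x) \<ge> \<lambda>(y)\<close>, the induction
  hypothesis for the predecessors of \<open>x\<close> makes (P3) applicable. If \<open>\<lambda>\<^sup>*(x) < \<lambda>\<^sup>*(y)\<close> and
  \<open>\<lambda>(x) \<le> \<lambda>(y)\<close>, cutting off a chain that realises \<open>\<lambda>\<^sup>*(y)\<close> yields some \<open>y' < y\<close> with
  \<open>\<lambda>\<^sup>*(x) \<le> \<lambda>\<^sup>*(y')\<close>, hence \<open>\<mu>(x) \<le> \<mu>(y') \<le> \<mu>(y)\<close>. As \<open>\<lambda>(y') < \<lambda>(y)\<close>, these are not
  all equal by (P2).\<close>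

section \<open>The lexicographic order on sets of natural numbers\<close>

text \<open>Trades infima in \<open>enat\<close> for a witness: if \<open>Y - X\<close> is nonempty,
  its least element is the first point of difference.\<close>

lemma lex_le_iff: "lex_le X Y \<longleftrightarrow> X = Y \<or> (\<exists>m\<in>Y - X. \<forall>k<m. k \<in> X \<longleftrightarrow> k \<in> Y)"
proof
  assume le: "lex_le X Y"
  show "X = Y \<or> (\<exists>m\<in>Y - X. \<forall>k<m. k \<in> X \<longleftrightarrow> k \<in> Y)"
  proof (cases "Y - X = {}")
    case True
    \<comment> \<open>The infimum over the empty \<open>Y - X\<close> is infinity, so no number is
      left for \<open>X - Y\<close>.\<close>
    have "n \<notin> X - Y" for n
    proof
      assume "n \<in> X - Y"
      then have "(INF n\<in>X - Y. enat n) \<le> enat n" by (rule INF_lower)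
      with le True show False by (simp add: lex_le_def top_enat_def)
    qed
    with True show ?thesis by blast
  next
    case False
    define m where "m = (LEAST n. n \<in> Y - X)"
    have m: "m \<in> Y - X"
      unfolding m_def by (rule LeastI_ex) (use False in blast)
    have least: "m \<le> k" if "k \<in> Y - X" for k
      unfolding m_def using that by (rule Least_le)
    have "enat m \<le> (INF n\<in>Y - X. enat n)"
      by (rule INF_greatest) (simp add: least)
    with le have *: "enat m \<le> (INF n\<in>X - Y. enat n)" by (simp add: lex_le_def)
    have "m \<le> k" if "k \<in> X - Y" for k
    proof -
      have "(INF n\<in>X - Y. enat n) \<le> enat k" using that by (rule INF_lower)
      with * have "enat m \<le> enat k" by (rule order_trans)
      then show ?thesis by simp
    qed
    then have "\<forall>k<m. k \<in> X \<longleftrightarrow> k \<in> Y" using least by (meson DiffI not_less)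
    with m show ?thesis by blast
  qed
next
  assume "X = Y \<or> (\<exists>m\<in>Y - X. \<forall>k<m. k \<in> X \<longleftrightarrow> k \<in> Y)"
  then show "lex_le X Y"
  proof
    assume "\<exists>m\<in>Y - X. \<forall>k<m. k \<in> X \<longleftrightarrow> k \<in> Y"
    then obtain m where m: "m \<in> Y - X" "\<forall>k<m. k \<in> X \<longleftrightarrow> k \<in> Y" by blast
    have "(INF n\<in>Y - X. enat n) \<le> enat m" using m(1) by (rule INF_lower)
    also have "enat m \<le> (INF n\<in>X - Y. enat n)"
      by (rule INF_greatest) (use m(2) in \<open>auto simp: not_less[symmetric]\<close>)
    finally show ?thesis by (simp add: lex_le_def)
  qed (simp add: lex_le_def)
qed

lemma lex_leI: "m \<in> Y \<Longrightarrow> m \<notin> X \<Longrightarrow> (\<And>k. k < m \<Longrightarrow> k \<in> X \<longleftrightarrow> k \<in> Y) \<Longrightarrow> lex_le X Y"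
  unfolding lex_le_iff by blast

lemma lex_le_refl: "lex_le X X"
  by (simp add: lex_le_iff)

lemma lex_le_subset: "X \<subseteq> Y \<Longrightarrow> lex_le X Y"
  by (simp add: lex_le_def Diff_eq_empty_iff[THEN iffD2] top_enat_def[symmetric])

lemma lex_le_antisym:
  assumes "lex_le X Y" "lex_le Y X"
  shows "X = Y"
proof (rule ccontr)
  assume "X \<noteq> Y"
  with assms obtain m n where
    "m \<in> Y - X" "\<forall>k<m. k \<in> X \<longleftrightarrow> k \<in> Y" "n \<in> X - Y" "\<forall>k<n. k \<in> Y \<longleftrightarrow> k \<in> X"
    unfolding lex_le_iff by metis
  then show False by (cases m n rule: linorder_cases) auto
qed

lemma lex_le_trans:
  assumes "lex_le X Y" "lex_le Y Z"
  shows "lex_le X Z"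
proof (cases "X = Y \<or> Y = Z")
  case False
  with assms obtain m n where
    m: "m \<in> Y - X" "\<forall>k<m. k \<in> X \<longleftrightarrow> k \<in> Y" and n: "n \<in> Z - Y" "\<forall>k<n. k \<in> Y \<longleftrightarrow> k \<in> Z"
    unfolding lex_le_iff by metis
  show ?thesis
    \<comment> \<open>The earlier of the two first differences separates \<open>X\<close> from
      \<open>Z\<close>.\<close>
    by (rule lex_leI[of "min m n"]; cases m n rule: linorder_cases) (use m n in auto)
qed (use assms in auto)

lemma lex_le_total: "lex_le X Y \<or> lex_le Y X"
proof (cases "X = Y")
  case False
  define m where "m = (LEAST n. n \<in> (Y - X) \<union> (X - Y))"
  have m: "m \<in> (Y - X) \<union> (X - Y)"
    unfolding m_def by (rule LeastI_ex) (use False in blast)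
  have "\<forall>k<m. k \<in> X \<longleftrightarrow> k \<in> Y"
    unfolding m_def by (auto dest: not_less_Least)
  with m show ?thesis unfolding lex_le_iff by blast
qed (simp add: lex_le_refl)

lemma finite_lex_max:
  assumes "finite A" "A \<noteq> {}"
  shows "\<exists>M\<in>A. \<forall>X\<in>A. lex_le X M"
  using assms
proof (induction A rule: finite_ne_induct)
  case (singleton X)
  then show ?case by (simp add: lex_le_refl)
next
  case (insert X A)
  then obtain M where "M \<in> A" "\<forall>Y\<in>A. lex_le Y M" by blast
  then show ?case using lex_le_total[of X M] by (metis insert_iff lex_le_refl lex_le_trans)
qed

section \<open>The Gabriel-Roiter measure, (P1) and (P2)\<close>

locale length_poset =
  fixes S :: "'a set" and r :: "'a rel" and lam :: "'a \<Rightarrow> nat"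
  assumes po: "partial_order_on S r" and len: "length_function S r lam"
begin

abbreviation gr :: "'a \<Rightarrow> nat set" where
  "gr \<equiv> gr_measure S r lam"

lemma le_refl: "x \<in> S \<Longrightarrow> (x, x) \<in> r"
  using po by (auto simp: partial_order_on_def preorder_on_def refl_on_def)

lemma le_trans: "(x, y) \<in> r \<Longrightarrow> (y, z) \<in> r \<Longrightarrow> (x, z) \<in> r"
  using po by (auto simp: partial_order_on_def preorder_on_def dest: transD)

lemma lam_strict: "x \<in> S \<Longrightarrow> y \<in> S \<Longrightarrow> (x, y) \<in> r \<Longrightarrow> x \<noteq> y \<Longrightarrow> lam x < lam y"
  using len by (auto simp: length_function_def strict_rel_def)

lemma lam_mono: "x \<in> S \<Longrightarrow> y \<in> S \<Longrightarrow> (x, y) \<in> r \<Longrightarrow> lam x \<le> lam y"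
  using lam_strict by (cases "x = y") (auto intro: less_imp_le)

lemma Ch_max_iff:
  "X \<in> Ch_max S r x \<longleftrightarrow> X \<subseteq> S \<and> finite X \<and> (\<forall>a\<in>X. \<forall>b\<in>X. (a, b) \<in> r \<or> (b, a) \<in> r) \<and>
     x \<in> X \<and> (\<forall>z\<in>X. (z, x) \<in> r)"
  by (auto simp: Ch_max_def Ch_def Chains_def)

text \<open>Justifies the definite description: the candidates are subsets of
  \<open>{..lam x}\<close>, \<open>{x}\<close> supplies one of them, and antisymmetry makes the
  maximum unique.\<close>

lemma gr_props:
  assumes x: "x \<in> S"
  shows gr_in: "gr x \<in> (`) lam ` Ch_max S r x"
    and gr_max: "X \<in> Ch_max S r x \<Longrightarrow> lex_le (lam ` X) (gr x)"
proof -
  let ?A = "(`) lam ` Ch_max S r x"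
  have "?A \<subseteq> Pow {..lam x}"
    using x lam_mono by (fastforce simp: Ch_max_iff)
  then have "finite ?A" by (rule finite_subset) simp
  moreover have "{x} \<in> Ch_max S r x" using x by (simp add: Ch_max_iff le_refl)
  ultimately obtain M where M: "M \<in> ?A" "\<forall>X\<in>?A. lex_le X M"
    using finite_lex_max[of ?A] by blast
  have "gr x \<in> ?A \<and> (\<forall>X\<in>Ch_max S r x. lex_le (lam ` X) (gr x))"
    unfolding gr_measure_def
  proof (rule theI)
    show "M \<in> ?A \<and> (\<forall>X\<in>Ch_max S r x. lex_le (lam ` X) M)" using M by blast
    show "N = M" if "N \<in> ?A \<and> (\<forall>X\<in>Ch_max S r x. lex_le (lam ` X) N)" for N
      by (rule lex_le_antisym) (use that M in auto)
  qed
  then show "gr x \<in> ?A" "X \<in> Ch_max S r x \<Longrightarrow> lex_le (lam ` X) (gr x)" by blast+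
qed

lemma gr_chain:
  assumes "x \<in> S"
  obtains X where "X \<in> Ch_max S r x" "gr x = lam ` X"
  using gr_in[OF assms] by blast

lemma lam_in_gr:
  assumes "x \<in> S"
  shows "lam x \<in> gr x"
proof -
  obtain X where "X \<in> Ch_max S r x" "gr x = lam ` X" using gr_chain assms .
  then show ?thesis by (simp add: Ch_max_iff)
qed

lemma gr_le_lam:
  assumes "x \<in> S" "n \<in> gr x"
  shows "n \<le> lam x"
proof -
  obtain X where X: "X \<in> Ch_max S r x" "gr x = lam ` X" using gr_chain assms(1) .
  with assms(2) obtain z where z: "z \<in> X" "n = lam z" by blast
  with X(1) have "z \<in> S" "(z, x) \<in> r" by (auto simp: Ch_max_iff)
  then show ?thesis using lam_mono assms(1) z(2) by simp
qed

text \<open>(P1): a chain realising \<open>gr x\<close> can be extended by \<open>y\<close>, and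
  enlarging a set moves it up lexicographically.\<close>

lemma gr_mono:
  assumes "x \<in> S" "y \<in> S" "(x, y) \<in> r"
  shows "lex_le (gr x) (gr y)"
proof -
  obtain X where X: "X \<in> Ch_max S r x" "gr x = lam ` X" using gr_chain assms(1) .
  have "insert y X \<in> Ch_max S r y"
    using X(1) assms(2) le_refl[of y] le_trans[OF _ assms(3)] by (simp add: Ch_max_iff)
  then have "lex_le (lam ` insert y X) (gr y)" by (rule gr_max[OF assms(2)])
  moreover have "lex_le (gr x) (lam ` insert y X)"
    using X(2) by (auto intro: lex_le_subset)
  ultimately show ?thesis by (blast intro: lex_le_trans)
qed

text \<open>(P2): \<open>lam x\<close> is the maximum of \<open>gr x\<close>, so the measure
  determines the length.\<close>

lemma gr_eq_lam: "x \<in> S \<Longrightarrow> y \<in> S \<Longrightarrow> gr x = gr y \<Longrightarrow> lam x = lam y"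
  by (metis gr_le_lam lam_in_gr order_antisym)

section \<open>Truncation of chains and (P3)\<close>

text \<open>Cut a chain realising \<open>gr y\<close> at its element \<open>z\<close> of length
  \<open>n\<close>; the lower piece competes in the maximum defining \<open>gr z\<close>.\<close>

lemma gr_truncate:
  assumes y: "y \<in> S" and n: "n \<in> gr y"
  obtains z where "z \<in> S" "(z, y) \<in> r" "lam z = n" "lex_le (gr y \<inter> {..n}) (gr z)"
proof -
  obtain Y where Y: "Y \<in> Ch_max S r y" "gr y = lam ` Y" using gr_chain y .
  obtain z where z: "z \<in> Y" "lam z = n" using n Y(2) by auto
  let ?Z = "{w \<in> Y. (w, z) \<in> r}"
  have zS: "z \<in> S" and zy: "(z, y) \<in> r" using Y(1) z by (auto simp: Ch_max_iff)
  have "?Z \<in> Ch_max S r z"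
    using Y(1) z(1) le_refl[OF zS] by (auto simp: Ch_max_iff)
  then have Z: "lex_le (lam ` ?Z) (gr z)" by (rule gr_max[OF zS])
  \<comment> \<open>A chain element not below \<open>z\<close> lies strictly above it, so its length
    exceeds \<open>n\<close>.\<close>
  have "w \<in> ?Z" if w: "w \<in> Y" "lam w \<le> n" for w
  proof (rule ccontr)
    assume "w \<notin> ?Z"
    with w z(1) Y(1) have "(z, w) \<in> r" "z \<noteq> w" "w \<in> S"
      using le_refl[OF zS] by (auto simp: Ch_max_iff)
    then have "lam z < lam w" using zS lam_strict by blast
    then show False using w z by simp
  qed
  then have "gr y \<inter> {..n} \<subseteq> lam ` ?Z" unfolding Y(2) by auto
  with Z have "lex_le (gr y \<inter> {..n}) (gr z)" by (blast intro: lex_le_trans lex_le_subset)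
  with zS zy z(2) show ?thesis using that by blast
qed

text \<open>Without its maximum \<open>lam x\<close>, the set \<open>gr x\<close> is bounded by the
  measure of a predecessor and so lies strictly below \<open>gr y\<close>. Restoring
  \<open>lam x\<close> does no harm, as the first difference is at most
  \<open>lam y \<le> lam x\<close>.\<close>

lemma gr_P3:
  assumes x: "x \<in> S" and y: "y \<in> S"
    and pred: "\<And>x'. x' \<in> S \<Longrightarrow> strict_rel r x' x \<Longrightarrow> lex_le (gr x') (gr y) \<and> gr x' \<noteq> gr y"
    and ge: "lam y \<le> lam x"
  shows "lex_le (gr x) (gr y)"
proof -
  let ?G = "gr x - {lam x}"
  have "lex_le ?G (gr y) \<and> ?G \<noteq> gr y"
  proof (cases "?G = {}")
    case True
    then show ?thesis using lam_in_gr[OF y] by (metis empty_iff empty_subsetI lex_le_subset)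
  next
    case False
    \<comment> \<open>The second largest element of \<open>gr x\<close>; cutting there gives a
      proper predecessor of \<open>x\<close>.\<close>
    define n where "n = Max ?G"
    have fin: "finite ?G"
      using gr_le_lam[OF x] by (metis bounded_nat_set_is_finite finite_Diff le_imp_less_Suc)
    then have n: "n \<in> ?G" "\<And>k. k \<in> ?G \<Longrightarrow> k \<le> n"
      unfolding n_def using False by (auto simp del: Diff_iff)
    obtain z where z: "z \<in> S" "(z, x) \<in> r" "lam z = n" "lex_le (gr x \<inter> {..n}) (gr z)"
      using gr_truncate[OF x, of n] n(1) by blast
    have "z \<noteq> x" using z(3) n(1) by auto
    with z pred[of z] have *: "lex_le (gr z) (gr y)" "gr z \<noteq> gr y"
      by (auto simp: strict_rel_def)
    have "?G \<subseteq> gr x \<inter> {..n}" using n(2) by auto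
    with z(4) have "lex_le ?G (gr z)" by (blast intro: lex_le_trans lex_le_subset)
    with * show ?thesis by (metis lex_le_antisym lex_le_trans)
  qed
  then obtain m where m: "m \<in> gr y" "m \<notin> ?G" "\<And>k. k < m \<Longrightarrow> k \<in> ?G \<longleftrightarrow> k \<in> gr y"
    unfolding lex_le_iff by blast
  have my: "m \<le> lam y" using gr_le_lam y m(1) by blast
  show ?thesis
  proof (cases "m < lam x")
    case True
    with m show ?thesis by (intro lex_leI[of m]) auto
  next
    case False
    with my ge have eq: "m = lam x" "lam y = lam x" by auto
    \<comment> \<open>Below \<open>m = lam x\<close> the sets agree, and \<open>m\<close> itself
      lies in \<open>gr y\<close>.\<close>
    have "gr x \<subseteq> gr y"
    proof
      fix k assume "k \<in> gr x"
      then show "k \<in> gr y"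
        using m(1) m(3)[of k] eq gr_le_lam[OF x, of k] by (cases "k = lam x") auto
    qed
    then show ?thesis by (rule lex_le_subset)
  qed
qed

lemma gr_less_pred:
  assumes x: "x \<in> S" and y: "y \<in> S"
    and less: "lex_le (gr x) (gr y)" "gr x \<noteq> gr y" and le: "lam x \<le> lam y"
  obtains z where "z \<in> S" "(z, y) \<in> r" "z \<noteq> y" "lex_le (gr x) (gr z)"
proof -
  obtain m where m: "m \<in> gr y" "m \<notin> gr x" "\<And>k. k < m \<Longrightarrow> k \<in> gr x \<longleftrightarrow> k \<in> gr y"
    using less by (auto simp: lex_le_iff)
  \<comment> \<open>The cutting point \<open>n\<close> is the first difference \<open>m\<close>, or
    \<open>lam x\<close> if \<open>m\<close> is already the top value \<open>lam y\<close>;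
    \<open>n < lam y\<close> ensures \<open>z \<noteq> y\<close>.\<close>
  have "\<exists>n\<in>gr y. n < lam y \<and> lex_le (gr x) (gr y \<inter> {..n})"
  proof (cases "m < lam y")
    case True
    have "lex_le (gr x) (gr y \<inter> {..m})" using m by (intro lex_leI[of m]) auto
    with True m(1) show ?thesis by blast
  next
    case False
    with gr_le_lam[OF y m(1)] have "m = lam y" by simp
    moreover have "lam x \<noteq> m" using lam_in_gr[OF x] m(2) by auto
    ultimately have lt: "lam x < m" using le by simp
    then have "gr x \<subseteq> gr y \<inter> {..lam x}"
      using gr_le_lam[OF x] m(3) by (meson IntI atMost_iff le_less_trans subsetI)
    then show ?thesis
      using lt \<open>m = lam y\<close> lam_in_gr[OF x] by (blast intro: lex_le_subset)
  qed
  then obtain n where n: "n \<in> gr y" "n < lam y" "lex_le (gr x) (gr y \<inter> {..n})" by blast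
  obtain z where z: "z \<in> S" "(z, y) \<in> r" "lam z = n" "lex_le (gr y \<inter> {..n}) (gr z)"
    using gr_truncate[OF y n(1)] .
  with n have "z \<noteq> y" "lex_le (gr x) (gr z)" by (auto intro: lex_le_trans)
  with z that show ?thesis by blast
qed

lemma gr_conditions_gr: "gr_conditions S r lam UNIV {(X, Y). lex_le X Y} gr"
proof -
  \<comment> \<open>Any two distinct sets of naturals have a first difference, so the whole type can
    serve as carrier.\<close>
  have "partial_order_on UNIV {(X, Y). lex_le X Y}"
    unfolding partial_order_on_def preorder_on_def
    by (auto intro!: refl_onI transI antisymI lex_le_refl
        intro: lex_le_trans dest: lex_le_antisym)
  moreover have "(gr x, gr y) \<in> {(X, Y). lex_le X Y}"
    if "x \<in> S" "y \<in> S" "lam y \<le> lam x"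
      "\<forall>x'\<in>S. strict_rel r x' x \<longrightarrow> strict_rel {(X, Y). lex_le X Y} (gr x') (gr y)" for x y
    using gr_P3[OF that(1,2) _ that(3)] that(4)
    by (simp add: strict_rel_def[of "{(X, Y). lex_le X Y}"])
  ultimately show ?thesis
    unfolding gr_conditions_def using gr_mono gr_eq_lam by blast
qed

section \<open>Comparison with an arbitrary map satisfying (P1)-(P3)\<close>

lemma gr_conditions_mono:
  assumes mu: "gr_conditions S r lam P p mu" and "x \<in> S" "y \<in> S" "lex_le (gr x) (gr y)"
  shows "(mu x, mu y) \<in> p \<and> (gr x \<noteq> gr y \<longrightarrow> mu x \<noteq> mu y)"
  using assms(2-)
proof (induction "lam x + lam y" arbitrary: x y rule: less_induct)
  case less
  have antisym: "antisym p" and trans: "trans p"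
    using mu unfolding gr_conditions_def partial_order_on_def preorder_on_def by blast+
  have P1: "(mu a, mu b) \<in> p" if "a \<in> S" "b \<in> S" "(a, b) \<in> r" for a b
    using mu that unfolding gr_conditions_def by blast
  have P2: "lam a = lam b" if "a \<in> S" "b \<in> S" "mu a = mu b" for a b
    using mu that unfolding gr_conditions_def by blast
  have P3: "(mu a, mu b) \<in> p" if "a \<in> S" "b \<in> S" "lam b \<le> lam a"
    "\<And>a'. a' \<in> S \<Longrightarrow> strict_rel r a' a \<Longrightarrow> strict_rel p (mu a') (mu b)" for a b
    using mu that unfolding gr_conditions_def by blast
  \<comment> \<open>Proved before the case split because both cases use it; equal lengths occur in
    the first.\<close>
  have strict: "(mu x, mu y) \<in> p \<and> mu x \<noteq> mu y" if gr_less: "gr x \<noteq> gr y" "lam x \<le> lam y"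
  proof -
    obtain z where z: "z \<in> S" "(z, y) \<in> r" "z \<noteq> y" "lex_le (gr x) (gr z)"
      using gr_less_pred[OF less.prems gr_less] .
    have lt: "lam z < lam y" using z less.prems lam_strict by blast
    then have xz: "(mu x, mu z) \<in> p" using less.hyps[of x z] less.prems z by simp
    have zy: "(mu z, mu y) \<in> p" using P1 z less.prems by blast
    have "mu x \<noteq> mu y"
    proof
      assume "mu x = mu y"
      \<comment> \<open>\<open>mu z\<close> is squeezed between equal values.\<close>
      with xz zy have "mu z = mu y" by (auto intro: antisymD[OF antisym])
      then show False using P2[of z y] z less.prems lt by simp
    qed
    with xz zy show ?thesis by (blast intro: transD[OF trans])
  qed
  show ?case
  proof (cases "lam y \<le> lam x")
    case True
    have "strict_rel p (mu x') (mu y)" if x': "x' \<in> S" "strict_rel r x' x" for x'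
    proof -
      have lt: "lam x' < lam x"
        using x' less.prems(1) lam_strict by (simp add: strict_rel_def)
      have le: "lex_le (gr x') (gr x)"
        using gr_mono x' less.prems(1) by (simp add: strict_rel_def)
      then have "lex_le (gr x') (gr y)" using less.prems(3) by (rule lex_le_trans)
      moreover have "gr x' \<noteq> gr y"
      proof
        assume "gr x' = gr y"
        then have "gr x' = gr x" using lex_le_antisym[OF le] less.prems(3) by simp
        then show False using gr_eq_lam[OF x'(1) less.prems(1)] lt by simp
      qed
      ultimately show ?thesis
        using less.hyps[of x' y] lt x' less.prems by (simp add: strict_rel_def)
    qed
    with True less.prems have "(mu x, mu y) \<in> p" by (intro P3)
    \<comment> \<open>Different lengths are separated by (P2); for equal lengths
      \<open>strict\<close> applies.\<close>
    moreover have "mu x \<noteq> mu y" if "gr x \<noteq> gr y"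
      using strict[OF that] P2[of x y] less.prems by auto
    ultimately show ?thesis by blast
  next
    case False
    then have "gr x \<noteq> gr y" using gr_eq_lam[of x y] less.prems by auto
    with strict False show ?thesis by simp
  qed
qed

text \<open>The converse rests on totality: otherwise \<open>gr y\<close> is strictly below
  \<open>gr x\<close>, hence \<open>mu y\<close> strictly below \<open>mu x\<close>, against
  antisymmetry.\<close>

lemma gr_conditions_iff:
  assumes mu: "gr_conditions S r lam P p mu" and x: "x \<in> S" and y: "y \<in> S"
  shows "(mu x, mu y) \<in> p \<longleftrightarrow> lex_le (gr x) (gr y)"
proof
  assume le: "(mu x, mu y) \<in> p"
  have "antisym p" using mu unfolding gr_conditions_def partial_order_on_def by blast
  then show "lex_le (gr x) (gr y)"
    using le gr_conditions_mono[OF mu y x] lex_le_total[of "gr x" "gr y"]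
    by (metis antisymD)
qed (use gr_conditions_mono[OF mu x y] in blast)

end

theorem mainTheorem1:
  fixes S :: "'a set" and r :: "'a rel" and lam :: "'a \<Rightarrow> nat"
  assumes "partial_order_on S r"
    and "length_function S r lam"
  shows "\<exists>(P :: nat set set) p (mu :: 'a \<Rightarrow> nat set).
    gr_conditions S r lam P p mu \<and>
    (\<forall>x\<in>S. \<forall>y\<in>S. (mu x, mu y) \<in> p \<longleftrightarrow> lex_le (gr_measure S r lam x) (gr_measure S r lam y)) \<and>
    (\<forall>(P' :: 'b set) p' mu'. gr_conditions S r lam P' p' mu' \<longrightarrow>
       (\<forall>x\<in>S. \<forall>y\<in>S. (mu' x, mu' y) \<in> p' \<longleftrightarrow> (mu x, mu y) \<in> p))"
proof -
  interpret length_poset S r lam using assms by unfold_locales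
  show ?thesis
  proof (intro exI conjI allI impI ballI)
    \<comment> \<open>With \<open>gr\<close> as the witness, the first equivalence unfolds the order
      and the second is \<open>gr_conditions_iff\<close> for \<open>mu'\<close>.\<close>
    show "gr_conditions S r lam UNIV {(X, Y). lex_le X Y} gr" by (rule gr_conditions_gr)
  qed (simp_all add: gr_conditions_iff)
qed

end
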